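(* Let $a>b>0$, $c=\sqrt{a^2-b^2}$, and let $\mathcal{E}$ be the ellipse $(x/a)^2+(y/b)^2=1$. The circle with center $C_2=\left[0,\frac{c\,b}{2a}\right]$ and radius $r_2=\frac{b}{2}$ is a caustic admitting a Poncelet family of triangles inscribed in $\mathcal{E}$, and over this family the barycenter $X_2$ is stationary at $\left[0,\frac{c\,b}{3a}\right]$.
   Context: Points of the plane are written $[x,y]$. A circle is a caustic admitting a Poncelet family of triangles inscribed in $\mathcal{E}$ if every point of $\mathcal{E}$ is a vertex of a triangle whose three vertices lie on $\mathcal{E}$ and whose three sidelines are tangent to the circle (here, the circle is the fixed incircle of the triangles); the family is the set of all such triangles. The barycenter $X_2$ is the centroid of the triangle's three vertices. A point is stationary over a family if it is the same for all triangles in the family. *)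

theory Defs
  imports "HOL-Analysis.Analysis"
begin

type_synonym point = "real ^ 2"

text \<open>A triangle is the ordered triple of its vertices.\<close>

type_synonym triangle = "point \<times> point \<times> point"

definition ellipse :: "real \<Rightarrow> real \<Rightarrow> point set" where
  "ellipse a b = {p. (p $ 1 / a)\<^sup>2 + (p $ 2 / b)\<^sup>2 = 1}"

fun vertices :: "triangle \<Rightarrow> point set" where
  "vertices (A, B, C) = {A, B, C}"

fun sidelines :: "triangle \<Rightarrow> point set set" where
  "sidelines (A, B, C) = {affine hull {A, B}, affine hull {B, C}, affine hull {C, A}}"

definition nondegenerate :: "triangle \<Rightarrow> bool" where
  "nondegenerate T \<longleftrightarrow> \<not> collinear (vertices T)"

text \<open>The circle with center \<open>O'\<close> and radius \<open>r\<close> is \<open>sphere O' r\<close>.  For a line and a circle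
  of positive radius, tangency means having exactly one point in common.\<close>

definition tangent_to_circle :: "point set \<Rightarrow> point \<Rightarrow> real \<Rightarrow> bool" where
  "tangent_to_circle l O' r \<longleftrightarrow> (\<exists>!p. p \<in> l \<inter> sphere O' r)"

definition is_incircle :: "point \<Rightarrow> real \<Rightarrow> triangle \<Rightarrow> bool" where
  "is_incircle O' r T \<longleftrightarrow> 0 < r \<and> cball O' r \<subseteq> convex hull (vertices T) \<and>
     (\<forall>l \<in> sidelines T. tangent_to_circle l O' r)"

definition poncelet_family :: "point set \<Rightarrow> point \<Rightarrow> real \<Rightarrow> triangle set" where
  "poncelet_family E O' r =
     {T. nondegenerate T \<and> vertices T \<subseteq> E \<and> (\<forall>l \<in> sidelines T. tangent_to_circle l O' r)}"

definition is_poncelet_caustic :: "point set \<Rightarrow> point \<Rightarrow> real \<Rightarrow> bool" where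
  "is_poncelet_caustic E O' r \<longleftrightarrow>
     0 < r \<and> (\<forall>P \<in> E. \<exists>T \<in> poncelet_family E O' r. P \<in> vertices T)"

fun barycenter :: "triangle \<Rightarrow> point" where
  "barycenter (A, B, C) = (1 / 3) *\<^sub>R (A + B + C)"

definition stationary_at :: "(triangle \<Rightarrow> point) \<Rightarrow> triangle set \<Rightarrow> point \<Rightarrow> bool" where
  "stationary_at X F p \<longleftrightarrow> (\<forall>T \<in> F. X T = p)"

end

theory Submission
  imports Defs
begin

text \<open>The affine map \<open>stretch a b\<close> carries the unit circle onto the ellipse.  Put \<open>e = c / a\<close>, the
  eccentricity, and \<open>h = [0, e]\<close>; the circle then has centre \<open>stretch a b [0, e/2]\<close> and radius
  \<open>b / 2\<close>.  The theorem comes from one fact, \<open>tangent_chord_iff\<close>: for distinct unit vectors \<open>z\<close>, \<open>w\<close>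
  the chord of the ellipse between their images is tangent to the circle if and only if
  \<open>\<bar>z + w - h\<bar> = 1\<close>.  In other words, \<open>h - z - w\<close> is again a point of the unit circle, so every
  tangent chord comes with a third point of the ellipse, the one that completes it to a triangle
  with centroid \<open>stretch a b (h / 3) = [0, c b / (3 a)]\<close>.

  Three distinct unit vectors with sum \<open>h\<close> therefore give a triangle with three tangent sides,
  and since \<open>\<bar>h\<bar> = e < 1\<close>, every unit vector belongs to such a triple (\<open>unit_triple_exists\<close>).
  Conversely, the tangency of two sides at a vertex \<open>z\<^sub>1\<close> forces the other two vertices to be the two
  intersections of the unit circle with its translate by \<open>h - z\<^sub>1\<close>, and these add up to \<open>h - z\<^sub>1\<close>
  (\<open>sum_circle_intersections\<close>).  The family is thus exactly the set of images of such triples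
  (\<open>poncelet_family_iff\<close>), and the barycenter is constant.

  Tangency of the three sides does not distinguish the incircle from an excircle.  For this one
  compares the signed area of a triangle of the family with those of the triangles that the centre
  of the circle spans with its sides (\<open>centre_inside\<close>): the signs agree, so the centre lies inside,
  and a disc about an inner point whose boundary only touches the sidelines stays inside.\<close>

section \<open>Signed areas, tangency and incircles in the plane\<close>

lemma norm_sq_plane: "(norm (z :: point))\<^sup>2 = (z $ 1)\<^sup>2 + (z $ 2)\<^sup>2"
  unfolding power2_norm_eq_inner by (simp add: inner_vec_def sum_2 power2_eq_square)

lemma lagrange_identity_plane:
  fixes u v :: point
  shows "(u $ 1 * v $ 2 - u $ 2 * v $ 1)\<^sup>2 + (u \<bullet> v)\<^sup>2 = (norm u)\<^sup>2 * (norm v)\<^sup>2"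
  unfolding norm_sq_plane inner_vec_def sum_2 inner_real_def by algebra

text \<open>Twice the signed area of the triangle \<open>P Q R\<close>.\<close>

definition orient :: "point \<Rightarrow> point \<Rightarrow> point \<Rightarrow> real" where
  "orient P Q R = (Q $ 1 - P $ 1) * (R $ 2 - P $ 2) - (Q $ 2 - P $ 2) * (R $ 1 - P $ 1)"

lemma orient_rotate: "orient P Q R = orient Q R P"
  unfolding orient_def by (simp add: algebra_simps)

lemma collinear_imp_orient_eq_0:
  assumes "collinear {P, Q, R}"
  shows "orient P Q R = 0"
  using assms unfolding collinear_3_expand
proof (elim disjE exE)
  fix u assume Q: "Q = u *\<^sub>R P + (1 - u) *\<^sub>R R"
  show ?thesis unfolding Q by (simp add: orient_def algebra_simps)
qed (simp add: orient_def)

lemma ex1_shifted_square_iff: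
  fixes D s k :: real
  assumes "D \<noteq> 0"
  shows "(\<exists>!t. (D * t - s)\<^sup>2 = k) \<longleftrightarrow> k = 0"
proof
  assume ex1: "\<exists>!t. (D * t - s)\<^sup>2 = k"
  then obtain t where t: "(D * t - s)\<^sup>2 = k" by blast
  \<comment> \<open>Reflecting a solution in \<open>s / D\<close> gives a solution.\<close>
  have "(D * (2 * s / D - t) - s)\<^sup>2 = k"
    using t assms by (simp add: power2_eq_square algebra_simps)
  with ex1 t have "2 * s / D - t = t" by blast
  with assms have "D * t = s" by (simp add: field_simps)
  with t show "k = 0" by simp
next
  assume "k = 0"
  with assms show "\<exists>!t. (D * t - s)\<^sup>2 = k"
    by (intro ex1I[of _ "s / D"]) (auto simp: field_simps)
qed

lemma ex1_in_range_iff: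
  assumes "inj X"
  shows "(\<exists>!p. p \<in> range X \<inter> S) \<longleftrightarrow> (\<exists>!t. X t \<in> S)"
proof
  assume ex1: "\<exists>!p. p \<in> range X \<inter> S"
  then obtain t where t: "X t \<in> S" by blast
  show "\<exists>!t. X t \<in> S"
  proof (rule ex1I[of _ t])
    fix u assume "X u \<in> S"
    with ex1 t have "X u = X t" by blast
    then show "u = t" by (rule injD[OF assms])
  qed (fact t)
next
  assume "\<exists>!t. X t \<in> S"
  then obtain t where "X t \<in> S" "\<And>u. X u \<in> S \<Longrightarrow> u = t" by blast
  then show "\<exists>!p. p \<in> range X \<inter> S"
    by (intro ex1I[of _ "X t"]) blast+
qed

text \<open>The distance from \<open>M\<close> to the line \<open>P Q\<close> is \<open>\<bar>orient P Q M\<bar> / dist P Q\<close>.  Along the line, the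
  squared distance to \<open>M\<close> is a quadratic function of the parameter, and completing the square
  makes this distance its minimum.\<close>

lemma tangent_to_circle_line_iff:
  assumes "P \<noteq> Q" and "0 < r"
  shows "tangent_to_circle (affine hull {P, Q}) M r \<longleftrightarrow> (orient P Q M)\<^sup>2 = r\<^sup>2 * (dist P Q)\<^sup>2"
proof -
  define D where "D = (dist P Q)\<^sup>2"
  define s where "s = (M - P) \<bullet> (Q - P)"
  define X where "X = (\<lambda>t. P + t *\<^sub>R (Q - P))"
  have D: "D > 0" "D = (Q $ 1 - P $ 1)\<^sup>2 + (Q $ 2 - P $ 2)\<^sup>2"
    using assms(1) norm_sq_plane[of "Q - P"] unfolding D_def
    by (simp, simp add: dist_norm norm_minus_commute)
  have on_circle: "X t \<in> sphere M r \<longleftrightarrow> (D * t - s)\<^sup>2 = D * r\<^sup>2 - (orient P Q M)\<^sup>2" for t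
  proof -
    have "D * (dist M (X t))\<^sup>2 = (D * t - s)\<^sup>2 + (orient P Q M)\<^sup>2"
      unfolding dist_norm norm_sq_plane s_def X_def orient_def D(2)
      by (simp add: inner_vec_def sum_2) algebra
    moreover have "X t \<in> sphere M r \<longleftrightarrow> D * (dist M (X t))\<^sup>2 = D * r\<^sup>2"
      using assms(2) D(1) by (simp add: power2_eq_iff_nonneg)
    ultimately show ?thesis by auto
  qed
  have "inj X"
    using assms(1) by (auto simp: inj_on_def X_def)
  moreover have "affine hull {P, Q} = range X"
    unfolding affine_hull_2_alt X_def ..
  ultimately have "tangent_to_circle (affine hull {P, Q}) M r \<longleftrightarrow> (\<exists>!t. X t \<in> sphere M r)"
    unfolding tangent_to_circle_def by (simp only: ex1_in_range_iff)
  also have "\<dots> \<longleftrightarrow> D * r\<^sup>2 - (orient P Q M)\<^sup>2 = 0"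
    unfolding on_circle using D(1) by (intro ex1_shifted_square_iff) simp
  finally show ?thesis unfolding D_def by (auto simp: mult.commute)
qed

text \<open>As a function of \<open>X\<close>, \<open>orient X P Q\<close> is affine with gradient of length \<open>dist P Q\<close>.  On a disc
  whose boundary is tangent to the line \<open>P Q\<close> it can therefore not change its sign.\<close>

lemma orient_sign_on_disc:
  assumes "(orient M P Q)\<^sup>2 = r\<^sup>2 * (dist P Q)\<^sup>2" and "0 < orient M P Q * k"
    and "X \<in> cball M r"
  shows "0 \<le> orient X P Q * k"
proof -
  have diff: "orient X P Q - orient M P Q = (X - M) $ 1 * (P - Q) $ 2 - (X - M) $ 2 * (P - Q) $ 1"
    unfolding orient_def by (simp add: algebra_simps)
  have "(orient X P Q - orient M P Q)\<^sup>2 \<le> (dist M X)\<^sup>2 * (dist P Q)\<^sup>2"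
    using lagrange_identity_plane[of "X - M" "P - Q"] zero_le_power2[of "(X - M) \<bullet> (P - Q)"]
    unfolding diff dist_norm norm_minus_commute[of M X] by linarith
  also have "\<dots> \<le> r\<^sup>2 * (dist P Q)\<^sup>2"
    using assms(3) by (intro mult_right_mono power_mono) auto
  finally have "\<bar>orient X P Q - orient M P Q\<bar> \<le> \<bar>orient M P Q\<bar>"
    unfolding assms(1)[symmetric] by (simp add: abs_le_square_iff)
  with assms(2) show ?thesis
    by (auto simp: zero_less_mult_iff zero_le_mult_iff)
qed

text \<open>The ratios of signed areas are the barycentric coordinates of \<open>X\<close>.\<close>

lemma in_convex_hull_triangle:
  assumes "orient P Q R \<noteq> 0"
    and "0 \<le> orient X Q R * orient P Q R"
    and "0 \<le> orient X R P * orient P Q R"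
    and "0 \<le> orient X P Q * orient P Q R"
  shows "X \<in> convex hull {P, Q, R}"
proof -
  define k where "k = orient P Q R"
  define u where "u = orient X Q R / k"
  define v where "v = orient X R P / k"
  define w where "w = orient X P Q / k"
  have k: "k \<noteq> 0" using assms(1) unfolding k_def .
  have "0 \<le> u" "0 \<le> v" "0 \<le> w"
    using assms(2-4) unfolding u_def v_def w_def k_def
    by (auto simp: zero_le_mult_iff zero_le_divide_iff)
  moreover have "u + v + w = 1"
  proof -
    have "orient X Q R + orient X R P + orient X P Q = k"
      unfolding k_def orient_def by algebra
    then show ?thesis
      using k unfolding u_def v_def w_def by (simp add: add_divide_distrib[symmetric])
  qed
  moreover have "X = u *\<^sub>R P + v *\<^sub>R Q + w *\<^sub>R R"
  proof -
    have "\<forall>i. k * X $ i = orient X Q R * P $ i + orient X R P * Q $ i + orient X P Q * R $ i"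
      unfolding forall_2 k_def orient_def by (simp add: algebra_simps)
    then show ?thesis
      using k unfolding vec_eq_iff u_def v_def w_def by (simp add: field_simps)
  qed
  ultimately show ?thesis unfolding convex_hull_3 by blast
qed

text \<open>An excircle is tangent to all sidelines too, but its centre is separated from the triangle by
  one of them; the sign conditions say that \<open>M\<close> is not.\<close>

lemma is_incircle_if_centre_inside:
  assumes "0 < r" and tangent: "\<forall>l \<in> sidelines (P, Q, R). tangent_to_circle l M r"
    and "0 < orient M Q R * orient P Q R"
    and "0 < orient M R P * orient P Q R"
    and "0 < orient M P Q * orient P Q R"
  shows "is_incircle M r (P, Q, R)"
proof -
  have nz: "orient P Q R \<noteq> 0" using assms(3) by auto
  then have "P \<noteq> Q" "Q \<noteq> R" "R \<noteq> P" by (auto simp: orient_def)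
  with tangent \<open>0 < r\<close> have
    "(orient M P Q)\<^sup>2 = r\<^sup>2 * (dist P Q)\<^sup>2"
    "(orient M Q R)\<^sup>2 = r\<^sup>2 * (dist Q R)\<^sup>2"
    "(orient M R P)\<^sup>2 = r\<^sup>2 * (dist R P)\<^sup>2"
    by (simp_all add: tangent_to_circle_line_iff orient_rotate[of M])
  with assms(3-5) have "X \<in> convex hull {P, Q, R}" if "X \<in> cball M r" for X
    using that by (intro in_convex_hull_triangle nz) (blast intro: orient_sign_on_disc)+
  with assms(1,2) show ?thesis
    unfolding is_incircle_def by auto
qed

section \<open>Triples of unit vectors with a given sum\<close>

text \<open>Both \<open>z\<close> and \<open>w\<close> lie on the perpendicular bisector of the segment from \<open>0\<close> to \<open>d\<close>, at the same
  distance from \<open>0\<close>; they are mirror images in the line \<open>0 d\<close>.\<close>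

lemma sum_circle_intersections:
  fixes z w d :: point
  assumes "norm z = 1" "norm w = 1" "norm (z - d) = 1" "norm (w - d) = 1" "z \<noteq> w" "d \<noteq> 0"
  shows "z + w = d"
proof -
  have on_bisector: "v \<bullet> d = d \<bullet> d / 2" if "norm v = 1" "norm (v - d) = 1" for v
    using that unfolding norm_eq_1 by (simp add: inner_diff inner_commute)
  define s where "s = z + w - d"
  define u where "u = z - w"
  have "s \<bullet> d = 0" "u \<bullet> d = 0"
    using assms(1-4) unfolding s_def u_def by (simp_all add: inner_simps on_bisector)
  moreover have "s \<bullet> u = 0"
    using assms(1-4) on_bisector[of z] on_bisector[of w] unfolding s_def u_def norm_eq_1
    by (simp add: inner_simps inner_commute)
  \<comment> \<open>The Gram determinant of three vectors in the plane vanishes; here it is the product of the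
    squared norms, so one of the vectors is zero.\<close>
  moreover have "(s \<bullet> s) * (u \<bullet> u) * (d \<bullet> d) + 2 * (s \<bullet> u) * (u \<bullet> d) * (s \<bullet> d)
      - (s \<bullet> s) * (u \<bullet> d)\<^sup>2 - (u \<bullet> u) * (s \<bullet> d)\<^sup>2 - (d \<bullet> d) * (s \<bullet> u)\<^sup>2 = 0"
    unfolding inner_vec_def sum_2 inner_real_def power2_eq_square by (simp add: algebra_simps)
  ultimately show ?thesis
    using assms(5,6) by (simp add: s_def u_def)
qed

text \<open>The remaining two vectors are the endpoints of the chord of the unit circle with midpoint
  \<open>(h - z) / 2\<close>.  This is a proper chord because \<open>0 < \<bar>h - z\<bar> < 2\<close>.\<close>

lemma unit_triple_exists:
  fixes z h :: point
  assumes "norm z = 1" "norm h < 1"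
  obtains w w' :: point where "norm w = 1" "norm w' = 1" "z + w + w' = h" "w \<noteq> w'"
proof -
  define s where "s = h - z"
  define N where "N = (norm s)\<^sup>2"
  define m where "m = sqrt (1 / N - 1 / 4)"
  define p :: point where "p = vector [- s $ 2, s $ 1]"
  have "0 < norm s" "norm s < 2"
    using assms norm_triangle_ineq4[of h z] norm_triangle_ineq2[of z h]
    by (auto simp: s_def norm_minus_commute)
  then have "0 < N" "N < 2\<^sup>2"
    unfolding N_def by (simp, intro power_strict_mono) auto
  then have m: "m > 0" "m\<^sup>2 = 1 / N - 1 / 4"
    unfolding m_def by (auto simp: field_simps)
  have N: "N = (s $ 1)\<^sup>2 + (s $ 2)\<^sup>2"
    unfolding N_def norm_sq_plane ..
  have unit: "norm ((1 / 2) *\<^sub>R s + t *\<^sub>R p) = 1" if "t\<^sup>2 = m\<^sup>2" for t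
  proof -
    have "(norm ((1 / 2) *\<^sub>R s + t *\<^sub>R p))\<^sup>2 = N / 4 + t\<^sup>2 * N"
      unfolding norm_sq_plane N p_def by (simp add: power2_eq_square field_simps)
    also have "\<dots> = 1"
      using \<open>0 < N\<close> unfolding that m(2) by (simp add: field_simps)
    finally show ?thesis by (simp add: abs_square_eq_1)
  qed
  have "p \<noteq> 0"
    using \<open>0 < N\<close> unfolding N p_def by (auto simp: vec_eq_iff forall_2)
  show thesis
  proof (rule that)
    show "norm ((1 / 2) *\<^sub>R s + m *\<^sub>R p) = 1" "norm ((1 / 2) *\<^sub>R s + (- m) *\<^sub>R p) = 1"
      by (rule unit; simp)+
    show "z + ((1 / 2) *\<^sub>R s + m *\<^sub>R p) + ((1 / 2) *\<^sub>R s + (- m) *\<^sub>R p) = h"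
      unfolding s_def by (simp add: vec_eq_iff field_simps)
    show "(1 / 2) *\<^sub>R s + m *\<^sub>R p \<noteq> (1 / 2) *\<^sub>R s + (- m) *\<^sub>R p"
      using m(1) \<open>p \<noteq> 0\<close> by (simp flip: scaleR_minus_left)
  qed
qed

text \<open>With \<open>S = z\<^sub>2 + z\<^sub>3\<close>, the chord \<open>z\<^sub>2 z\<^sub>3\<close> of the unit circle is orthogonal to \<open>S\<close>, and \<open>orient q z\<^sub>2 z\<^sub>3\<close>
  is a multiple of \<open>q \<bullet> S - \<bar>S\<bar>\<^sup>2 / 2\<close>.  Since \<open>S = [0, e] - z\<^sub>1\<close>, this last function has at \<open>[0, e/2]\<close> the
  value \<open>- (1 - e y) / 2\<close> and at \<open>z\<^sub>1\<close> the value \<open>- (3 + e\<^sup>2 - 4 e y) / 2\<close>, where \<open>y\<close> is the second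
  coordinate of \<open>z\<^sub>1\<close>.  Both are negative because \<open>y \<le> 1\<close> and \<open>3 + e\<^sup>2 - 4 e = (1 - e) (3 - e)\<close>.\<close>

lemma centre_inside:
  fixes z\<^sub>1 z\<^sub>2 z\<^sub>3 :: point
  assumes "norm z\<^sub>1 = 1" "norm z\<^sub>2 = 1" "norm z\<^sub>3 = 1" and sum: "z\<^sub>1 + z\<^sub>2 + z\<^sub>3 = vector [0, e]"
    and "z\<^sub>2 \<noteq> z\<^sub>3" and e: "0 < e" "e < 1"
  shows "0 < orient (vector [0, e / 2]) z\<^sub>2 z\<^sub>3 * orient z\<^sub>1 z\<^sub>2 z\<^sub>3"
proof -
  have unit: "(z\<^sub>1 $ 1)\<^sup>2 + (z\<^sub>1 $ 2)\<^sup>2 = 1" "(z\<^sub>2 $ 1)\<^sup>2 + (z\<^sub>2 $ 2)\<^sup>2 = 1"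
      "(z\<^sub>3 $ 1)\<^sup>2 + (z\<^sub>3 $ 2)\<^sup>2 = 1"
    using assms(1-3) norm_sq_plane[of z\<^sub>1] norm_sq_plane[of z\<^sub>2] norm_sq_plane[of z\<^sub>3] by simp_all
  have sums: "z\<^sub>1 $ 1 + z\<^sub>2 $ 1 + z\<^sub>3 $ 1 = 0" "z\<^sub>1 $ 2 + z\<^sub>2 $ 2 + z\<^sub>3 $ 2 = e"
    using arg_cong[OF sum, of "\<lambda>v. v $ 1"] arg_cong[OF sum, of "\<lambda>v. v $ 2"] by simp_all
  \<comment> \<open>The factor \<open>1 + e\<^sup>2 - 2 e y\<close> is \<open>\<bar>S\<bar>\<^sup>2\<close>.\<close>
  have "4 * (1 + e\<^sup>2 - 2 * e * z\<^sub>1 $ 2) * (orient (vector [0, e / 2]) z\<^sub>2 z\<^sub>3 * orient z\<^sub>1 z\<^sub>2 z\<^sub>3)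
      = (norm (z\<^sub>2 - z\<^sub>3))\<^sup>2 * ((1 - e * z\<^sub>1 $ 2) * (3 + e\<^sup>2 - 4 * e * z\<^sub>1 $ 2))"
    using unit sums unfolding orient_def norm_sq_plane by simp algebra
  moreover have "0 < (norm (z\<^sub>2 - z\<^sub>3))\<^sup>2 * ((1 - e * z\<^sub>1 $ 2) * (3 + e\<^sup>2 - 4 * e * z\<^sub>1 $ 2))"
    and "0 < 4 * (1 + e\<^sup>2 - 2 * e * z\<^sub>1 $ 2)"
  proof -
    have "z\<^sub>1 $ 2 \<le> 1"
      using component_le_norm_cart[of z\<^sub>1 2] assms(1) by simp
    then have "e * z\<^sub>1 $ 2 \<le> e" using e mult_left_mono[of "z\<^sub>1 $ 2" 1 e] by simp
    moreover have "0 < (1 - e) * (3 - e)" "0 < (1 - e)\<^sup>2" using e by simp_all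
    ultimately have "0 < 1 - e * z\<^sub>1 $ 2" "0 < 3 + e\<^sup>2 - 4 * e * z\<^sub>1 $ 2"
      "0 < 4 * (1 + e\<^sup>2 - 2 * e * z\<^sub>1 $ 2)"
      using e unfolding power2_eq_square by (auto simp only: algebra_simps)
    with assms(5) show "0 < (norm (z\<^sub>2 - z\<^sub>3))\<^sup>2 * ((1 - e * z\<^sub>1 $ 2) * (3 + e\<^sup>2 - 4 * e * z\<^sub>1 $ 2))"
      and "0 < 4 * (1 + e\<^sup>2 - 2 * e * z\<^sub>1 $ 2)"
      by simp_all
  qed
  ultimately show ?thesis by (metis zero_less_mult_pos)
qed

section \<open>The ellipse as the image of the unit circle\<close>

definition stretch :: "real \<Rightarrow> real \<Rightarrow> point \<Rightarrow> point" where
  "stretch a b z = vector [a * z $ 1, b * z $ 2]"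

lemma orient_stretch:
  "orient (stretch a b u) (stretch a b v) (stretch a b w) = a * b * orient u v w"
  unfolding orient_def stretch_def by (simp add: algebra_simps)

lemma stretch_eq_iff:
  assumes "a \<noteq> 0" "b \<noteq> 0"
  shows "stretch a b z = stretch a b w \<longleftrightarrow> z = w"
  using assms by (simp add: stretch_def vec_eq_iff forall_2)

lemma ellipse_eq_stretch_unit_circle:
  assumes "a \<noteq> 0" "b \<noteq> 0"
  shows "ellipse a b = stretch a b ` sphere 0 1"
proof -
  have norm_eq_1: "norm z = 1 \<longleftrightarrow> (z $ 1)\<^sup>2 + (z $ 2)\<^sup>2 = 1" for z :: point
    unfolding norm_sq_plane[symmetric] by (simp add: abs_square_eq_1)
  show ?thesis
  proof (intro equalityI subsetI)
    fix p assume "p \<in> ellipse a b"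
    with assms have "p = stretch a b (vector [p $ 1 / a, p $ 2 / b])"
      and "vector [p $ 1 / a, p $ 2 / b] \<in> sphere (0 :: point) 1"
      by (auto simp: stretch_def vec_eq_iff forall_2 norm_eq_1 ellipse_def)
    then show "p \<in> stretch a b ` sphere 0 1" by blast
  next
    fix p assume "p \<in> stretch a b ` sphere 0 1"
    with assms show "p \<in> ellipse a b"
      by (auto simp: stretch_def norm_eq_1 ellipse_def)
  qed
qed

text \<open>For unit vectors, the defect of the tangency condition factors through
  \<open>\<bar>z + w - [0, e]\<bar>\<^sup>2 - 1\<close>, the other factor being the nonzero \<open>\<bar>z - w\<bar>\<^sup>2\<close>.\<close>

lemma tangent_chord_iff:
  fixes z w :: point
  assumes "0 < a" "0 < b" and e: "b\<^sup>2 = a\<^sup>2 * (1 - e\<^sup>2)"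
    and "norm z = 1" "norm w = 1" "z \<noteq> w"
  shows "tangent_to_circle (affine hull {stretch a b z, stretch a b w})
      (stretch a b (vector [0, e / 2])) (b / 2) \<longleftrightarrow> norm (z + w - vector [0, e]) = 1"
proof -
  let ?M = "vector [0, e / 2] :: point" and ?h = "vector [0, e] :: point"
  have unit: "(z $ 1)\<^sup>2 + (z $ 2)\<^sup>2 = 1" "(w $ 1)\<^sup>2 + (w $ 2)\<^sup>2 = 1"
    using assms(4,5) norm_sq_plane[of z] norm_sq_plane[of w] by simp_all
  have factor: "(2 * orient z w ?M)\<^sup>2 - (z $ 1 - w $ 1)\<^sup>2 - (1 - e\<^sup>2) * (z $ 2 - w $ 2)\<^sup>2
      = (norm (z - w))\<^sup>2 * ((norm (z + w - ?h))\<^sup>2 - 1)"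
    using unit unfolding orient_def norm_sq_plane vector_2 vector_minus_component
      vector_add_component by algebra
  have dist: "(dist (stretch a b z) (stretch a b w))\<^sup>2
      = a\<^sup>2 * ((z $ 1 - w $ 1)\<^sup>2 + (1 - e\<^sup>2) * (z $ 2 - w $ 2)\<^sup>2)"
    unfolding dist_norm norm_sq_plane stretch_def using e by simp algebra
  have "tangent_to_circle (affine hull {stretch a b z, stretch a b w}) (stretch a b ?M) (b / 2)
      \<longleftrightarrow> (a * b * orient z w ?M)\<^sup>2 = (b / 2)\<^sup>2 * (dist (stretch a b z) (stretch a b w))\<^sup>2"
    using assms by (simp add: tangent_to_circle_line_iff stretch_eq_iff orient_stretch)
  also have "\<dots> \<longleftrightarrow> (a * b)\<^sup>2 * (2 * orient z w ?M)\<^sup>2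
      = (a * b)\<^sup>2 * ((z $ 1 - w $ 1)\<^sup>2 + (1 - e\<^sup>2) * (z $ 2 - w $ 2)\<^sup>2)"
    unfolding dist by (simp add: power_mult_distrib power_divide field_simps)
  also have "\<dots> \<longleftrightarrow> (norm (z - w))\<^sup>2 * ((norm (z + w - ?h))\<^sup>2 - 1) = 0"
    unfolding factor[symmetric] using assms(1,2) by auto
  also have "\<dots> \<longleftrightarrow> norm (z + w - ?h) = 1"
    using assms(6) by (simp add: abs_square_eq_1)
  finally show ?thesis .
qed

section \<open>The Poncelet family\<close>

locale poncelet_ellipse =
  fixes a b e :: real
  assumes pos: "0 < a" "0 < b" and e: "0 < e" "e < 1" and b_sq: "b\<^sup>2 = a\<^sup>2 * (1 - e\<^sup>2)"
begin

abbreviation "centre \<equiv> stretch a b (vector [0, e / 2])"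

abbreviation "family \<equiv> poncelet_family (ellipse a b) centre (b / 2)"

text \<open>By \<open>tangent_chord_iff\<close>, the two tangents from \<open>z\<^sub>1\<close> place \<open>z\<^sub>2\<close> and \<open>z\<^sub>3\<close> on the unit circle about
  \<open>[0, e] - z\<^sub>1\<close>.  In the other direction, \<open>z\<^sub>2 \<noteq> z\<^sub>3\<close> already makes the triangle nondegenerate, because
  its signed area is a factor of the positive product in \<open>centre_inside\<close>.\<close>

lemma poncelet_family_iff:
  assumes unit: "norm z\<^sub>1 = 1" "norm z\<^sub>2 = 1" "norm z\<^sub>3 = 1"
  shows "(stretch a b z\<^sub>1, stretch a b z\<^sub>2, stretch a b z\<^sub>3) \<in> family
    \<longleftrightarrow> z\<^sub>2 \<noteq> z\<^sub>3 \<and> z\<^sub>1 + z\<^sub>2 + z\<^sub>3 = vector [0, e]"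
    (is "?T \<in> _ \<longleftrightarrow> _ \<and> _ = ?h")
proof
  assume T: "?T \<in> family"
  then have "\<not> collinear {stretch a b z\<^sub>1, stretch a b z\<^sub>2, stretch a b z\<^sub>3}"
    by (simp add: poncelet_family_def nondegenerate_def)
  then have distinct: "z\<^sub>1 \<noteq> z\<^sub>2" "z\<^sub>2 \<noteq> z\<^sub>3" "z\<^sub>3 \<noteq> z\<^sub>1"
    by (auto simp: insert_commute)
  with T unit pos b_sq have tangent: "norm (z\<^sub>1 + z\<^sub>2 - ?h) = 1" "norm (z\<^sub>3 + z\<^sub>1 - ?h) = 1"
    by (simp_all add: poncelet_family_def tangent_chord_iff)
  have "norm ?h = e"
    using e norm_sq_plane[of ?h] by (simp add: power2_eq_iff_nonneg)
  with unit(1) e have "?h - z\<^sub>1 \<noteq> 0" by auto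
  with unit(2,3) tangent distinct(2) have "z\<^sub>2 + z\<^sub>3 = ?h - z\<^sub>1"
    by (intro sum_circle_intersections) (simp_all add: algebra_simps)
  with distinct(2) show "z\<^sub>2 \<noteq> z\<^sub>3 \<and> z\<^sub>1 + z\<^sub>2 + z\<^sub>3 = ?h"
    by (simp add: algebra_simps)
next
  assume "z\<^sub>2 \<noteq> z\<^sub>3 \<and> z\<^sub>1 + z\<^sub>2 + z\<^sub>3 = ?h"
  then have "z\<^sub>2 \<noteq> z\<^sub>3" and sum: "z\<^sub>1 + z\<^sub>2 + z\<^sub>3 = ?h" by simp_all
  from centre_inside[OF unit sum this(1) e]
  have orient: "orient z\<^sub>1 z\<^sub>2 z\<^sub>3 \<noteq> 0" by auto
  then have distinct: "z\<^sub>1 \<noteq> z\<^sub>2" "z\<^sub>2 \<noteq> z\<^sub>3" "z\<^sub>3 \<noteq> z\<^sub>1"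
    by (auto simp: orient_def)
  have "z\<^sub>1 + z\<^sub>2 - ?h = - z\<^sub>3" "z\<^sub>2 + z\<^sub>3 - ?h = - z\<^sub>1" "z\<^sub>3 + z\<^sub>1 - ?h = - z\<^sub>2"
    using sum by (simp_all add: algebra_simps eq_neg_iff_add_eq_0 flip: sum)
  with distinct unit pos b_sq
  have "\<forall>l \<in> sidelines ?T. tangent_to_circle l centre (b / 2)"
    by (simp add: tangent_chord_iff)
  moreover have "nondegenerate ?T"
    using orient pos collinear_imp_orient_eq_0[of "stretch a b z\<^sub>1" "stretch a b z\<^sub>2" "stretch a b z\<^sub>3"]
    by (auto simp: nondegenerate_def orient_stretch)
  moreover have "vertices ?T \<subseteq> ellipse a b"
    using unit pos by (simp add: ellipse_eq_stretch_unit_circle)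
  ultimately show "?T \<in> family"
    by (simp add: poncelet_family_def)
qed

lemma poncelet_family_cases:
  assumes "T \<in> family"
  obtains z\<^sub>1 z\<^sub>2 z\<^sub>3 where "T = (stretch a b z\<^sub>1, stretch a b z\<^sub>2, stretch a b z\<^sub>3)"
    "norm z\<^sub>1 = 1" "norm z\<^sub>2 = 1" "norm z\<^sub>3 = 1" "z\<^sub>1 + z\<^sub>2 + z\<^sub>3 = vector [0, e]"
    "z\<^sub>1 \<noteq> z\<^sub>2" "z\<^sub>2 \<noteq> z\<^sub>3" "z\<^sub>3 \<noteq> z\<^sub>1"
proof -
  obtain P Q R where T: "T = (P, Q, R)" by (cases T)
  with assms have "{P, Q, R} \<subseteq> stretch a b ` sphere 0 1" and nc: "\<not> collinear {P, Q, R}"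
    using pos by (auto simp: poncelet_family_def nondegenerate_def ellipse_eq_stretch_unit_circle)
  then obtain z\<^sub>1 z\<^sub>2 z\<^sub>3 where z: "P = stretch a b z\<^sub>1" "Q = stretch a b z\<^sub>2" "R = stretch a b z\<^sub>3"
    "norm z\<^sub>1 = 1" "norm z\<^sub>2 = 1" "norm z\<^sub>3 = 1" by auto
  moreover from nc have "z\<^sub>1 \<noteq> z\<^sub>2" "z\<^sub>2 \<noteq> z\<^sub>3" "z\<^sub>3 \<noteq> z\<^sub>1"
    unfolding z by (auto simp: insert_commute)
  ultimately show thesis
    using assms poncelet_family_iff T that by blast
qed

lemma caustic: "is_poncelet_caustic (ellipse a b) centre (b / 2)"
  unfolding is_poncelet_caustic_def
proof (intro conjI ballI)
  fix P assume "P \<in> ellipse a b"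
  then obtain z where z: "P = stretch a b z" "norm z = 1"
    using pos by (auto simp: ellipse_eq_stretch_unit_circle)
  have "norm (vector [0, e] :: point) < 1"
    using e norm_sq_plane[of "vector [0, e]"] by (simp add: power2_eq_iff_nonneg)
  from unit_triple_exists[OF z(2) this] obtain w w' where
    "norm w = 1" "norm w' = 1" "z + w + w' = vector [0, e]" "w \<noteq> w'" .
  with z have "(P, stretch a b w, stretch a b w') \<in> family"
    by (simp add: poncelet_family_iff)
  then show "\<exists>T \<in> family. P \<in> vertices T" by force
qed (use pos in simp)

lemma incircle:
  assumes "T \<in> family"
  shows "is_incircle centre (b / 2) T"
proof -
  obtain z\<^sub>1 z\<^sub>2 z\<^sub>3 where T: "T = (stretch a b z\<^sub>1, stretch a b z\<^sub>2, stretch a b z\<^sub>3)"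
    and unit: "norm z\<^sub>1 = 1" "norm z\<^sub>2 = 1" "norm z\<^sub>3 = 1"
    and sum: "z\<^sub>1 + z\<^sub>2 + z\<^sub>3 = vector [0, e]"
    and distinct: "z\<^sub>1 \<noteq> z\<^sub>2" "z\<^sub>2 \<noteq> z\<^sub>3" "z\<^sub>3 \<noteq> z\<^sub>1"
    by (rule poncelet_family_cases[OF assms])
  from sum have sums: "z\<^sub>2 + z\<^sub>3 + z\<^sub>1 = vector [0, e]" "z\<^sub>3 + z\<^sub>1 + z\<^sub>2 = vector [0, e]"
    by (simp_all only: ac_simps)
  let ?M = "vector [0, e / 2] :: point"
  have inside: "0 < orient ?M z\<^sub>2 z\<^sub>3 * orient z\<^sub>1 z\<^sub>2 z\<^sub>3"
    "0 < orient ?M z\<^sub>3 z\<^sub>1 * orient z\<^sub>2 z\<^sub>3 z\<^sub>1"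
    "0 < orient ?M z\<^sub>1 z\<^sub>2 * orient z\<^sub>3 z\<^sub>1 z\<^sub>2"
    by (rule centre_inside; fact unit sum sums distinct e)+
  note inside = inside(1) inside(2)[folded orient_rotate[of z\<^sub>1 z\<^sub>2 z\<^sub>3]]
    inside(3)[unfolded orient_rotate[of z\<^sub>3 z\<^sub>1 z\<^sub>2]]
  have scale: "0 < a * b * k * (a * b * l)" if "0 < k * l" for k l
  proof -
    have "0 < (a * b)\<^sup>2 * (k * l)" using that pos by simp
    then show ?thesis by (simp add: power2_eq_square ac_simps)
  qed
  show ?thesis
    unfolding T
  proof (rule is_incircle_if_centre_inside, unfold orient_stretch)
    show "\<forall>l \<in> sidelines (stretch a b z\<^sub>1, stretch a b z\<^sub>2, stretch a b z\<^sub>3).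
        tangent_to_circle l centre (b / 2)"
      using assms unfolding T poncelet_family_def by blast
  qed (use pos inside in \<open>simp_all add: scale\<close>)
qed

lemma barycenter_eq:
  assumes "T \<in> family"
  shows "barycenter T = stretch a b (vector [0, e / 3])"
proof -
  obtain z\<^sub>1 z\<^sub>2 z\<^sub>3 where T: "T = (stretch a b z\<^sub>1, stretch a b z\<^sub>2, stretch a b z\<^sub>3)"
    and sum: "z\<^sub>1 + z\<^sub>2 + z\<^sub>3 = vector [0, e]"
    by (rule poncelet_family_cases[OF assms])
  have "barycenter T = (1 / 3) *\<^sub>R stretch a b (z\<^sub>1 + z\<^sub>2 + z\<^sub>3)"
    unfolding T by (simp add: stretch_def vec_eq_iff forall_2 algebra_simps)
  also have "\<dots> = stretch a b (vector [0, e / 3])"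
    unfolding sum by (simp add: stretch_def vec_eq_iff forall_2)
  finally show ?thesis .
qed

end

theorem proposition3:
  fixes a b c r\<^sub>2 :: real and C\<^sub>2 :: point
  assumes "a > b" and "b > 0"
    and "c = sqrt (a\<^sup>2 - b\<^sup>2)"
    and "C\<^sub>2 = vector [0, c * b / (2 * a)]"
    and "r\<^sub>2 = b / 2"
  shows "is_poncelet_caustic (ellipse a b) C\<^sub>2 r\<^sub>2
    \<and> (\<forall>T \<in> poncelet_family (ellipse a b) C\<^sub>2 r\<^sub>2. is_incircle C\<^sub>2 r\<^sub>2 T)
    \<and> stationary_at barycenter (poncelet_family (ellipse a b) C\<^sub>2 r\<^sub>2)
        (vector [0, c * b / (3 * a)])"
proof -
  define e where "e = c / a"
  have "b\<^sup>2 < a\<^sup>2" using assms(1,2) by (intro power_strict_mono) auto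
  then have c: "0 < c" "c\<^sup>2 = a\<^sup>2 - b\<^sup>2" using assms(3) by simp_all
  then have "c\<^sup>2 < a\<^sup>2" using assms(2) by simp
  then have "c < a" using assms(1,2) by (auto intro: power_less_imp_less_base)
  interpret poncelet_ellipse a b e
  proof
    have "a * e = c" using assms(1,2) by (simp add: e_def)
    then show "b\<^sup>2 = a\<^sup>2 * (1 - e\<^sup>2)"
      using c(2) by (simp add: right_diff_distrib flip: power_mult_distrib)
  qed (use assms(1,2) c \<open>c < a\<close> in \<open>simp_all add: e_def\<close>)
  have "C\<^sub>2 = centre" "vector [0, c * b / (3 * a)] = stretch a b (vector [0, e / 3])"
    unfolding assms(4) by (simp_all add: stretch_def e_def mult.commute)
  then show ?thesis
    unfolding stationary_at_def assms(5) using caustic incircle barycenter_eq by simp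
qed

end
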